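(* Let $\mathbf{R}=[\mathbf{R}_{x,y}\ \ \mathbf{R}_z]\in\mathbb{R}^{3\times3}$ be a rotation matrix, where $\mathbf{R}_{x,y}\in\mathbb{R}^{3\times 2}$ consists of the first two columns and $\mathbf{R}_z\in\mathbb{R}^3$ is the third column, and let $\mathbf{t}\in\mathbb{R}^3$, $\mathbf{p}_{max}\in\mathbb{R}^2$. Let $\mathbf{f},\boldsymbol{\kappa},\mathbf{r}\in\mathbb{R}^3$, $\hat{\mathbf{p}},\hat{\mathbf{c}}\in\mathbb{R}^2$ and $\hat{\tau}\in\mathbb{R}$ satisfy $\mathbf{R}_z^T\mathbf{f}>0$ and $$\boldsymbol{\kappa}=\mathbf{R}_z\hat{\tau}+(\mathbf{R}_{x,y}\hat{\mathbf{p}}+\mathbf{t}-\mathbf{r})\times\mathbf{f}.$$ Then, with inequalities between vectors understood componentwise, $$\hat{\mathbf{p}}-\hat{\mathbf{c}}\le\mathbf{p}_{max}\iff(\mathbf{p}_{max}+\hat{\mathbf{c}})\,\mathbf{R}_z^T\mathbf{f}\ \ge\ -\begin{bmatrix}0&1\\-1&0\end{bmatrix}\left(\mathbf{R}_{x,y}^T\boldsymbol{\kappa}+\mathbf{R}_{x,y}^T\big((\mathbf{r}-\mathbf{t})\times\mathbf{f}\big)\right).$$ Moreover, there is a function $\mathbf{s}\in\mathcal{Q}_\pm$ of the variables $(\mathbf{f},\boldsymbol{\kappa},\mathbf{r},\hat{\mathbf{c}})$, depending only on $\mathbf{R},\mathbf{t},\mathbf{p}_{max}$, such that for all such data the two-sided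 center of pressure constraint $-\mathbf{p}_{max}\le\hat{\mathbf{p}}-\hat{\mathbf{c}}\le\mathbf{p}_{max}$ is equivalent to $\mathbf{s}(\mathbf{f},\boldsymbol{\kappa},\mathbf{r},\hat{\mathbf{c}})\le\mathbf{0}$.
   Context: $\mathcal{Q}_{+}$ is the set of functions $\mathbf{s}:\mathbb{R}^n\to\mathbb{R}^m$ (for any $n,m$) such that for each $i=1,\dots,m$ there exist a symmetric positive semidefinite matrix $\mathbf{Q}_i\in\mathbb{R}^{n\times n}$, a vector $\mathbf{q}_i\in\mathbb{R}^n$ and $c_i\in\mathbb{R}$ with $s_i(\mathbf{x})=\mathbf{x}^T\mathbf{Q}_i\mathbf{x}+\mathbf{q}_i^T\mathbf{x}+c_i$ for all $\mathbf{x}$. $\mathcal{Q}_{\pm}$ is the set of functions $\mathbf{s}:\mathbb{R}^n\to\mathbb{R}^m$ such that there exist $\mathbf{s}'\in\mathcal{Q}_{+}$ (with quadratic matrices $\mathbf{Q}_i$) and symmetric positive semidefinite matrices $\mathbf{P}_i\in\mathbb{R}^{n\times n}$ with $s_i(\mathbf{x})=s'_i(\mathbf{x})-\mathbf{x}^T\mathbf{P}_i\mathbf{x}$ for all $\mathbf{x}$ and $i=1,\dots,m$. Interpretation: $\mathbf{r}$ is the center of mass; the contact force $\mathbf{f}$ and the torque $\mathbf{R}_z\hat\tau$ normal to the contact surface act at the center of pressure $\mathbf{R}_{x,y}\hat{\mathbf{p}}+\mathbf{t}$; $\boldsymbol\kappa$ is the equivalent torque at $\mathbf{r}$; $\hat{\mathbf{c}}$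 is the contact location in local surface coordinates and $\mathbf{p}_{max}$ the support limits. *)

theory Defs
  imports "HOL-Analysis.Analysis"
begin

definition psd_matrix :: "real^'n^'n \<Rightarrow> bool" where
  "psd_matrix A \<longleftrightarrow> transpose A = A \<and> (\<forall>x. 0 \<le> x \<bullet> (A *v x))"

definition Q_plus :: "(real^'n \<Rightarrow> real^'m) set" where
  "Q_plus = {s. \<forall>i. \<exists>Q q c. psd_matrix Q \<and>
                  (\<forall>x. s x $ i = x \<bullet> (Q *v x) + q \<bullet> x + c)}"

definition Q_pm :: "(real^'n \<Rightarrow> real^'m) set" where
  "Q_pm = {s. \<exists>s' \<in> Q_plus. \<exists>P :: 'm \<Rightarrow> real^'n^'n.
                (\<forall>i. psd_matrix (P i)) \<and>
                (\<forall>i x. s x $ i = s' x $ i - x \<bullet> (P i *v x))}"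

definition cols_xy :: "real^3^3 \<Rightarrow> real^2^3" where
  "cols_xy R = transpose (vector [column 1 R, column 2 R])"

definition col_z :: "real^3^3 \<Rightarrow> real^3" where
  "col_z R = column 3 R"

text \<open>Block vectors: an index of the concatenation is a tagged index of one of the two parts.\<close>

definition vec_append :: "'a^'m \<Rightarrow> 'a^'n \<Rightarrow> 'a^('m + 'n)" (infixr \<open>@\<^sub>v\<close> 65) where
  "x @\<^sub>v y = (\<chi> i. case i of Inl j \<Rightarrow> x $ j | Inr k \<Rightarrow> y $ k)"

end

(* In the contact frame only the cross products of the columns of R matter: since R is a rotation,
   column 1 x column 2 = column 3, so the in-plane components of kappa + (r - t) x f are, up to
   order and sign, those of p multiplied by the positive normal force, and the constraints on p
   can be multiplied through by it. The result is a polynomial of degree 2 in (f, kappa, r, c),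
   and every such polynomial is a difference of convex ones because a product of two linear
   forms is a difference of two squares. *)

theory Submission
  imports Defs
begin

text \<open>The condition on a single component in \<open>Q_pm\<close>. The components are
  constrained independently of each other, so closure properties can be proved for scalar functions
  and assembled at the end.\<close>

definition dc_quadratic :: "(real^'n \<Rightarrow> real) \<Rightarrow> bool" where
  "dc_quadratic g \<longleftrightarrow> (\<exists>Q P q c. psd_matrix Q \<and> psd_matrix P \<and>
     (\<forall>x. g x = x \<bullet> (Q *v x) + q \<bullet> x + c - x \<bullet> (P *v x)))"

lemma dc_quadraticI:
  assumes "psd_matrix Q" "psd_matrix P"
    and "\<And>x. g x = x \<bullet> (Q *v x) + q \<bullet> x + c - x \<bullet> (P *v x)"
  shows "dc_quadratic g"
  using assms unfolding dc_quadratic_def by blast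

lemma Q_pmI:
  fixes s :: "real^'n \<Rightarrow> real^'m"
  assumes "\<And>i. dc_quadratic (\<lambda>x. s x $ i)"
  shows "s \<in> Q_pm"
proof -
  obtain Q P :: "'m \<Rightarrow> real^'n^'n" and q c where QP: "\<And>i. psd_matrix (Q i)" "\<And>i. psd_matrix (P i)"
    and s: "\<And>i x. s x $ i = x \<bullet> (Q i *v x) + q i \<bullet> x + c i - x \<bullet> (P i *v x)"
    using assms unfolding dc_quadratic_def by metis
  define s' :: "real^'n \<Rightarrow> real^'m" where "s' x = (\<chi> i. x \<bullet> (Q i *v x) + q i \<bullet> x + c i)" for x
  have "s' \<in> Q_plus"
    using QP by (auto simp: Q_plus_def s'_def)
  moreover have "s x $ i = s' x $ i - x \<bullet> (P i *v x)" for i x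
    by (simp add: s s'_def)
  ultimately show ?thesis
    using QP(2) unfolding Q_pm_def by blast
qed

lemma psd_matrix_0: "psd_matrix 0"
  by (simp add: psd_matrix_def transpose_def vec_eq_iff)

lemma psd_matrix_add:
  assumes "psd_matrix A" "psd_matrix B"
  shows "psd_matrix (A + B)"
  using assms
  by (auto simp: psd_matrix_def transpose_def vec_eq_iff matrix_vector_mult_add_rdistrib inner_add_right)

text \<open>\<open>A\<close> is the outer product of \<open>a\<close> with itself, so its quadratic
  form is the square of a linear form. Sums of such matrices supply the nonzero quadratic parts
  below.\<close>

lemma psd_matrix_rank_1:
  fixes a :: "real^'n"
  defines "A \<equiv> (\<chi> i j. a $ i * a $ j)"
  shows "psd_matrix A" and "x \<bullet> (A *v x) = (a \<bullet> x)\<^sup>2"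
proof -
  have "A *v y = (a \<bullet> y) *\<^sub>R a" for y
    by (simp add: A_def matrix_vector_mult_def vec_eq_iff inner_vec_def sum_distrib_left
        sum_distrib_right mult_ac)
  then have *: "y \<bullet> (A *v y) = (a \<bullet> y)\<^sup>2" for y
    by (simp add: power2_eq_square inner_commute)
  then show "x \<bullet> (A *v x) = (a \<bullet> x)\<^sup>2" .
  show "psd_matrix A"
    unfolding psd_matrix_def * by (simp add: A_def transpose_def vec_eq_iff mult.commute)
qed

lemma dc_quadratic_const: "dc_quadratic (\<lambda>x. c)"
  by (rule dc_quadraticI[OF psd_matrix_0 psd_matrix_0, of _ 0 c]) simp

lemma linear_eq_inner:
  fixes g :: "real^'n \<Rightarrow> real"
  assumes "linear g"
  obtains a where "g = (\<lambda>x. a \<bullet> x)"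
proof
  \<comment> \<open>Riesz representation: the adjoint maps reals to vectors, and its value at 1
    represents \<open>g\<close>.\<close>
  show "g = (\<lambda>x. adjoint g 1 \<bullet> x)"
    using adjoint_works[OF assms, of _ 1] by (auto simp: inner_commute)
qed

lemma dc_quadratic_linear:
  assumes "linear g"
  shows "dc_quadratic g"
proof -
  obtain a where "g = (\<lambda>x. a \<bullet> x)"
    using linear_eq_inner[OF assms] .
  then show ?thesis
    by (intro dc_quadraticI[OF psd_matrix_0 psd_matrix_0, of _ a 0]) simp
qed

lemma dc_quadratic_add:
  assumes "dc_quadratic g" "dc_quadratic h"
  shows "dc_quadratic (\<lambda>x. g x + h x)"
proof -
  obtain Q P q c where g: "psd_matrix Q" "psd_matrix P"
      "\<And>x. g x = x \<bullet> (Q *v x) + q \<bullet> x + c - x \<bullet> (P *v x)"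
    using assms(1) unfolding dc_quadratic_def by blast
  obtain Q' P' q' c' where h: "psd_matrix Q'" "psd_matrix P'"
      "\<And>x. h x = x \<bullet> (Q' *v x) + q' \<bullet> x + c' - x \<bullet> (P' *v x)"
    using assms(2) unfolding dc_quadratic_def by blast
  show ?thesis
    by (rule dc_quadraticI[OF psd_matrix_add[OF g(1) h(1)] psd_matrix_add[OF g(2) h(2)],
          of _ "q + q'" "c + c'"])
      (simp add: g h matrix_vector_mult_add_rdistrib inner_add_right inner_add_left)
qed

lemma dc_quadratic_sum:
  assumes "\<And>i. i \<in> I \<Longrightarrow> dc_quadratic (g i)"
  shows "dc_quadratic (\<lambda>x. \<Sum>i\<in>I. g i x)"
  using assms
  by (induction I rule: infinite_finite_induct) (auto intro: dc_quadratic_const dc_quadratic_add)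

lemma dc_quadratic_linear_mult:
  assumes "linear g" "linear h"
  shows "dc_quadratic (\<lambda>x. g x * h x)"
proof -
  obtain a where a: "g = (\<lambda>x. a \<bullet> x)" using linear_eq_inner[OF assms(1)] .
  obtain b where b: "h = (\<lambda>x. b \<bullet> x)" using linear_eq_inner[OF assms(2)] .
  have polarization: "g x * h x = (((1/2) *\<^sub>R (a + b)) \<bullet> x)\<^sup>2 - (((1/2) *\<^sub>R (a - b)) \<bullet> x)\<^sup>2" for x
    by (simp add: a b inner_add_left inner_diff_left power2_eq_square field_simps)
  show ?thesis
    \<comment> \<open>The half sum gives the convex part and the half difference the subtracted one;
      there is no affine part.\<close>
    by (rule dc_quadraticI[OF psd_matrix_rank_1(1) psd_matrix_rank_1(1),
          of _ "(1/2) *\<^sub>R (a + b)" 0 0 "(1/2) *\<^sub>R (a - b)"])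
      (simp only: psd_matrix_rank_1(2) polarization, simp)
qed

text \<open>Expanding only the first argument in the standard basis leaves a finite sum of products
  of two linear forms, a coordinate of \<open>x\<close> and \<open>B (axis i 1)\<close>.\<close>

lemma dc_quadratic_bilinear:
  fixes B :: "real^'n \<Rightarrow> real^'n \<Rightarrow> real"
  assumes "bilinear B"
  shows "dc_quadratic (\<lambda>x. B x x)"
proof -
  have l: "linear (\<lambda>x. B x y)" and r: "linear (B y)" for y
    using assms by (auto simp: bilinear_def)
  have "B x x = (\<Sum>i\<in>UNIV. x $ i * B (axis i 1) x)" for x
  proof -
    have "B x x = B (\<Sum>i\<in>UNIV. x $ i *\<^sub>R axis i 1) x"
      by (simp add: basis_expansion flip: scalar_mult_eq_scaleR)
    also have "\<dots> = (\<Sum>i\<in>UNIV. x $ i * B (axis i 1) x)"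
      by (simp add: linear_sum[OF l] linear_scale[OF l])
    finally show ?thesis .
  qed
  moreover have "dc_quadratic (\<lambda>x. \<Sum>i\<in>UNIV. x $ i * B (axis i 1) x)"
    by (intro dc_quadratic_sum dc_quadratic_linear_mult r
        bounded_linear.linear[OF bounded_linear_vec_nth])
  ultimately show ?thesis
    by presburger
qed

text \<open>The common shape of all four constraint components. \<open>F\<close>, \<open>K\<close>,
  \<open>C\<close>, \<open>D\<close> will be the projections to force, torque, center of mass and
  contact location; \<sigma> selects the upper or lower bound, \<open>w\<close> is a signed tangent
  direction, \<open>z\<close> the normal and \<open>m\<close> a support limit.\<close>

lemma dc_quadratic_contact:
  fixes F K C :: "real^'n \<Rightarrow> real^3" and D :: "real^'n \<Rightarrow> real^2"
  assumes F: "linear F" and K: "linear K" and C: "linear C" and D: "linear D"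
  shows "dc_quadratic (\<lambda>x. \<sigma> * (w \<bullet> (K x + cross3 (C x - t) (F x))) - (z \<bullet> F x) * (m + \<sigma> * D x $ k))"
proof -
  \<comment> \<open>\<open>B\<close> collects the products of two variables. What remains has the
    fixed \<open>t\<close> or \<open>m\<close> as a factor or is the torque alone, hence is
    linear.\<close>
  define B where "B x y = \<sigma> * (w \<bullet> cross3 (C x) (F y)) - (z \<bullet> F x) * (\<sigma> * D y $ k)" for x y
  define l where "l x = \<sigma> * (w \<bullet> (K x - cross3 t (F x))) - (z \<bullet> F x) * m" for x
  note lin = linear_add[OF F] linear_add[OF K] linear_add[OF C] linear_add[OF D]
    linear_scale[OF F] linear_scale[OF K] linear_scale[OF C] linear_scale[OF D]
  have "bilinear B"
    unfolding bilinear_def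
    by (auto intro!: linearI simp: B_def lin cross_add_left cross_add_right cross_mult_left
        cross_mult_right inner_add_right algebra_simps)
  moreover have "linear l"
    by (rule linearI) (auto simp: l_def lin cross_add_right cross_mult_right inner_add_right
        inner_diff_right algebra_simps)
  ultimately have "dc_quadratic (\<lambda>x. B x x + l x)"
    by (intro dc_quadratic_add dc_quadratic_bilinear dc_quadratic_linear)
  also have "(\<lambda>x. B x x + l x) =
      (\<lambda>x. \<sigma> * (w \<bullet> (K x + cross3 (C x - t) (F x))) - (z \<bullet> F x) * (m + \<sigma> * D x $ k))"
    by (auto simp: B_def l_def inner_add_right inner_diff_right algebra_simps
        Cross3.left_diff_distrib)
  finally show ?thesis .
qed

text \<open>Rotations commute with the cross product, so this is the image under \<open>R\<close> of
  the identity e1 x e2 = e3.\<close>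

lemma cross3_columns_rotation_matrix:
  assumes "rotation_matrix R"
  shows "cross3 (column 1 R) (column 2 R) = column 3 R"
  using cross_rotation_matrix[OF assms, of "axis 1 1" "axis 2 1"]
  by (simp add: cross_basis matrix_vector_mult_basis)

lemma orthogonal_columns_inner:
  fixes R :: "real^'n^'n"
  assumes "orthogonal_matrix R"
  shows "column i R \<bullet> column j R = (if i = j then 1 else 0)"
  using assms by (auto simp: orthogonal_matrix_orthonormal_columns norm_eq_1 orthogonal_def)

lemma cols_xy_mult: "cols_xy R *v p = p $ 1 *\<^sub>R column 1 R + p $ 2 *\<^sub>R column 2 R"
  by (simp add: cols_xy_def matrix_vector_mult_def transpose_def vec_eq_iff sum_2)

lemma transpose_cols_xy_mult:
  "transpose (cols_xy R) *v v = vector [column 1 R \<bullet> v, column 2 R \<bullet> v]"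
  by (simp add: cols_xy_def matrix_vector_mult_def vec_eq_iff forall_2 inner_vec_def)

text \<open>Adding the moment of \<open>f\<close> with arm \<open>r - t\<close> cancels that arm in
  \<kappa>. Pairing with a tangent column then removes \<tau> by orthogonality, and the triple
  product turns the moment of \<open>p\<close> into the normal force times one coordinate. The minus
  sign comes from column 2 x column 1 = - column 3.\<close>

lemma center_of_pressure:
  assumes R: "rotation_matrix R"
    and \<kappa>: "\<kappa> = \<tau> *\<^sub>R col_z R + cross3 (cols_xy R *v p + t - r) f"
  defines "v \<equiv> \<kappa> + cross3 (r - t) f"
  shows "- (column 2 R \<bullet> v) = (col_z R \<bullet> f) * p $ 1"
    and "column 1 R \<bullet> v = (col_z R \<bullet> f) * p $ 2"
proof -
  have "orthogonal_matrix R"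
    using R by (simp add: rotation_matrix_def)
  note inner = orthogonal_columns_inner[OF this]
  have triple: "a \<bullet> cross3 b c = cross3 a b \<bullet> c" for a b c :: "real^3"
    by (simp add: cross3_simps)
  have v: "v = \<tau> *\<^sub>R column 3 R + cross3 (p $ 1 *\<^sub>R column 1 R + p $ 2 *\<^sub>R column 2 R) f"
    unfolding v_def \<kappa> cols_xy_mult col_z_def
    by (simp add: cross_add_left Cross3.left_diff_distrib)
  show "- (column 2 R \<bullet> v) = (col_z R \<bullet> f) * p $ 1"
    unfolding v
    by (simp add: inner_add_right inner triple cross_add_left cross_add_right cross_mult_left
        cross_mult_right cross_skew[of "column 2 R" "column 1 R"]
        cross3_columns_rotation_matrix[OF R] col_z_def)
  show "column 1 R \<bullet> v = (col_z R \<bullet> f) * p $ 2"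
    unfolding v
    by (simp add: inner_add_right inner triple cross_add_left cross_add_right cross_mult_left
        cross_mult_right cross3_columns_rotation_matrix[OF R] col_z_def)
qed

theorem mainTheorem3:
  fixes R :: "real^3^3" and t :: "real^3" and p_max :: "real^2"
  assumes "rotation_matrix R"
  shows "(\<forall>(f :: real^3) (\<kappa> :: real^3) (r :: real^3) (p :: real^2) (c :: real^2) (\<tau> :: real).
            col_z R \<bullet> f > 0 \<longrightarrow>
            \<kappa> = \<tau> *\<^sub>R col_z R + cross3 (cols_xy R *v p + t - r) f \<longrightarrow>
            (p - c \<le> p_max \<longleftrightarrow>
             (col_z R \<bullet> f) *\<^sub>R (p_max + c) \<ge>
               - ((vector [vector [0, 1], vector [-1, 0]] :: real^2^2) *v
                  (transpose (cols_xy R) *v \<kappa> + transpose (cols_xy R) *v cross3 (r - t) f))))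
       \<and> (\<exists>s :: real^(3 + 3 + 3 + 2) \<Rightarrow> real^4. s \<in> Q_pm \<and>
            (\<forall>(f :: real^3) (\<kappa> :: real^3) (r :: real^3) (p :: real^2) (c :: real^2) (\<tau> :: real).
               col_z R \<bullet> f > 0 \<longrightarrow>
               \<kappa> = \<tau> *\<^sub>R col_z R + cross3 (cols_xy R *v p + t - r) f \<longrightarrow>
               (- p_max \<le> p - c \<and> p - c \<le> p_max \<longleftrightarrow> s (f @\<^sub>v \<kappa> @\<^sub>v r @\<^sub>v c) \<le> 0)))"
proof (intro conjI allI impI)
  fix f \<kappa> r :: "real^3" and p c :: "real^2" and \<tau> :: real
  assume pos: "col_z R \<bullet> f > 0"
    and \<kappa>: "\<kappa> = \<tau> *\<^sub>R col_z R + cross3 (cols_xy R *v p + t - r) f"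
  let ?rhs = "- ((vector [vector [0, 1], vector [-1, 0]] :: real^2^2) *v
    (transpose (cols_xy R) *v \<kappa> + transpose (cols_xy R) *v cross3 (r - t) f))"
  \<comment> \<open>The negated quarter turn sends (a, b) to (-b, a), which matches the order and
    signs in \<open>center_of_pressure\<close>.\<close>
  have "?rhs = (col_z R \<bullet> f) *\<^sub>R p"
    using center_of_pressure[OF assms \<kappa>]
    unfolding matrix_vector_right_distrib[symmetric] transpose_cols_xy_mult
    by (simp add: vec_eq_iff forall_2 matrix_vector_mult_def sum_2 inner_add_right algebra_simps)
  then have "?rhs \<le> (col_z R \<bullet> f) *\<^sub>R (p_max + c) \<longleftrightarrow> p \<le> p_max + c"
    using pos by (simp add: less_eq_vec_def)
  also have "\<dots> \<longleftrightarrow> p - c \<le> p_max"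
    by (simp add: less_eq_vec_def diff_le_eq)
  finally show "p - c \<le> p_max \<longleftrightarrow> ?rhs \<le> (col_z R \<bullet> f) *\<^sub>R (p_max + c)"
    by blast
next
  \<comment> \<open>The index sum associates to the right, so each later block lies one
    \<open>Inr\<close> deeper.\<close>
  define F :: "real^(3 + 3 + 3 + 2) \<Rightarrow> real^3" where "F x = (\<chi> i. x $ Inl i)" for x
  define K :: "real^(3 + 3 + 3 + 2) \<Rightarrow> real^3" where "K x = (\<chi> i. x $ Inr (Inl i))" for x
  define C :: "real^(3 + 3 + 3 + 2) \<Rightarrow> real^3" where "C x = (\<chi> i. x $ Inr (Inr (Inl i)))" for x
  define D :: "real^(3 + 3 + 3 + 2) \<Rightarrow> real^2" where "D x = (\<chi> i. x $ Inr (Inr (Inr i)))" for x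
  have lin: "linear F" "linear K" "linear C" "linear D"
    by (auto intro!: linearI simp: F_def K_def C_def D_def vec_eq_iff)
  \<comment> \<open>\<open>k\<close> is the coordinate of \<open>p\<close> that \<open>w\<close>
    extracts: \<open>- column 2 R\<close> goes with 1 and \<open>column 1 R\<close> with 2. The sign
    \<sigma> = 1 encodes the upper bound, \<sigma> = -1 the lower one.\<close>
  define g where "g \<sigma> w k x =
    \<sigma> * (w \<bullet> (K x + cross3 (C x - t) (F x))) - (col_z R \<bullet> F x) * (p_max $ k + \<sigma> * D x $ k)"
    for \<sigma> w k x
  define s :: "real^(3 + 3 + 3 + 2) \<Rightarrow> real^4" where
    "s x = vector [g 1 (- column 2 R) 1 x, g 1 (column 1 R) 2 x,
       g (-1) (- column 2 R) 1 x, g (-1) (column 1 R) 2 x]" for x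
  have s: "s x $ 1 = g 1 (- column 2 R) 1 x" "s x $ 2 = g 1 (column 1 R) 2 x"
    "s x $ 3 = g (-1) (- column 2 R) 1 x" "s x $ 4 = g (-1) (column 1 R) 2 x" for x
    by (simp_all add: s_def vector_def)
  have "dc_quadratic (g \<sigma> w k)" for \<sigma> w k
    unfolding g_def by (rule dc_quadratic_contact[OF lin])
  then have "\<forall>i. dc_quadratic (\<lambda>x. s x $ i)"
    unfolding forall_4 s by blast
  then have "s \<in> Q_pm"
    by (intro Q_pmI) blast
  moreover have "- p_max \<le> p - c \<and> p - c \<le> p_max \<longleftrightarrow> s (f @\<^sub>v \<kappa> @\<^sub>v r @\<^sub>v c) \<le> 0"
    if pos: "col_z R \<bullet> f > 0"
      and \<kappa>: "\<kappa> = \<tau> *\<^sub>R col_z R + cross3 (cols_xy R *v p + t - r) f"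
    for f \<kappa> r p c \<tau>
  proof -
    let ?x = "f @\<^sub>v \<kappa> @\<^sub>v r @\<^sub>v c"
    have parts: "F ?x = f" "K ?x = \<kappa>" "C ?x = r" "D ?x = c"
      by (simp_all add: F_def K_def C_def D_def vec_append_def vec_eq_iff)
    \<comment> \<open>On admissible data each component is the normal force times the violation of
      one bound, although \<open>p\<close> and \<tau> are not arguments of \<open>s\<close>.
      Positivity of the force then makes the signs agree.\<close>
    have g: "g \<sigma> (- column 2 R) 1 ?x = (col_z R \<bullet> f) * (\<sigma> * (p - c) $ 1 - p_max $ 1)"
      "g \<sigma> (column 1 R) 2 ?x = (col_z R \<bullet> f) * (\<sigma> * (p - c) $ 2 - p_max $ 2)" for \<sigma>
      unfolding g_def parts inner_minus_left center_of_pressure[OF assms \<kappa>]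
      by (simp_all add: algebra_simps)
    show ?thesis
      using pos unfolding less_eq_vec_def forall_2 forall_4 s g
      by (auto simp: mult_le_0_iff)
  qed
  ultimately show "\<exists>s :: real^(3 + 3 + 3 + 2) \<Rightarrow> real^4. s \<in> Q_pm \<and>
      (\<forall>f \<kappa> r p c \<tau>. col_z R \<bullet> f > 0 \<longrightarrow>
         \<kappa> = \<tau> *\<^sub>R col_z R + cross3 (cols_xy R *v p + t - r) f \<longrightarrow>
         (- p_max \<le> p - c \<and> p - c \<le> p_max \<longleftrightarrow> s (f @\<^sub>v \<kappa> @\<^sub>v r @\<^sub>v c) \<le> 0))"
    by blast
qed

end
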